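(* Let $f:\{0,1\}^n\to\{0,1\}$ and $g:\{0,1\}^m\to\{0,1\}$ be Boolean functions. Then $\mathsf{mbs}(f\circ g)\leq \mathsf{fbs}(f)\cdot\mathsf{mbs}(g)$.
   Context: $(f\circ g)(x^1,\dots,x^n)=f(g(x^1),\dots,g(x^n))$ for $x^i\in\{0,1\}^m$. For $x$, $x^B$ denotes $x$ with the bits in $B$ flipped and $\mathrm{supp}(x)=\{i:x_i=1\}$. $\mathsf{fbs}(f,y)$ is the optimum of: maximize $\sum_{B\in W}b_B$ subject to $\sum_{B\in W:i\in B}b_B\le 1$ for all $i\in[n]$, $b_B\in[0,1]$, where $W=\{B\subseteq[n]: f(y^B)\ne f(y)\}$; $\mathsf{fbs}(f)=\max_y\mathsf{fbs}(f,y)$. A monotone sensitive block of $h$ at $x$ is a nonempty $B$ disjoint from $\mathrm{supp}(x)$ with $h(x^B)\neq h(x)$; $\mathsf{mbs}(h,x)$ is the maximum number of pairwise disjoint monotone sensitive blocks at $x$, and $\mathsf{mbs}(h)=\max_x\mathsf{mbs}(h,x)$. *)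

theory Defs
  imports Complex_Main "HOL-Library.FuncSet" "HOL-Library.Disjoint_Sets"
begin

text \<open>
  A point of the cube $\{0,1\}^I$ is an extensional function on the finite index set \<open>I\<close>, with
  \<open>True\<close> for 1. A Boolean function on the cube is a HOL function that is only ever evaluated
  on points of the cube, so its values elsewhere are irrelevant.
\<close>

definition cube :: "'i set \<Rightarrow> ('i \<Rightarrow> bool) set" where
  "cube I = (I \<rightarrow>\<^sub>E UNIV)"

text \<open>Only used with \<open>B \<subseteq> I\<close>, in which case it maps \<open>cube I\<close> to itself.\<close>

definition flip :: "('i \<Rightarrow> bool) \<Rightarrow> 'i set \<Rightarrow> 'i \<Rightarrow> bool" where
  "flip x B = (\<lambda>i. if i \<in> B then \<not> x i else x i)"

definition supp :: "'i set \<Rightarrow> ('i \<Rightarrow> bool) \<Rightarrow> 'i set" where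
  "supp I x = {i \<in> I. x i}"

text \<open>
  The argument $(x^1,\dots,x^n)$ of the composition is a single point of the cube over
  \<open>{1..n} \<times> {1..m}\<close>; coordinate \<open>(i, j)\<close> is bit $j$ of $x^i$.
\<close>

definition block_comp ::
  "nat \<Rightarrow> nat \<Rightarrow> ((nat \<Rightarrow> bool) \<Rightarrow> bool) \<Rightarrow> ((nat \<Rightarrow> bool) \<Rightarrow> bool) \<Rightarrow> (nat \<times> nat \<Rightarrow> bool) \<Rightarrow> bool" where
  "block_comp n m f g = (\<lambda>x. f (\<lambda>i\<in>{1..n}. g (\<lambda>j\<in>{1..m}. x (i, j))))"

definition sensitive_blocks :: "'i set \<Rightarrow> (('i \<Rightarrow> bool) \<Rightarrow> bool) \<Rightarrow> ('i \<Rightarrow> bool) \<Rightarrow> 'i set set" where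
  "sensitive_blocks I f y = {B. B \<subseteq> I \<and> f (flip y B) \<noteq> f y}"

definition fbs_feasible ::
  "'i set \<Rightarrow> (('i \<Rightarrow> bool) \<Rightarrow> bool) \<Rightarrow> ('i \<Rightarrow> bool) \<Rightarrow> ('i set \<Rightarrow> real) \<Rightarrow> bool" where
  "fbs_feasible I f y b \<longleftrightarrow>
     (\<forall>i\<in>I. (\<Sum>B\<in>{B \<in> sensitive_blocks I f y. i \<in> B}. b B) \<le> 1) \<and>
     (\<forall>B\<in>sensitive_blocks I f y. 0 \<le> b B \<and> b B \<le> 1)"

text \<open>
  For finite \<open>I\<close> the feasible weights, restricted to the sensitive blocks, form a nonempty compact
  polytope, so the supremum is the maximum of the linear program.
\<close>

definition fbs_at :: "'i set \<Rightarrow> (('i \<Rightarrow> bool) \<Rightarrow> bool) \<Rightarrow> ('i \<Rightarrow> bool) \<Rightarrow> real" where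
  "fbs_at I f y = Sup {(\<Sum>B\<in>sensitive_blocks I f y. b B) | b. fbs_feasible I f y b}"

definition fbs :: "'i set \<Rightarrow> (('i \<Rightarrow> bool) \<Rightarrow> bool) \<Rightarrow> real" where
  "fbs I f = Max (fbs_at I f ` cube I)"

definition monotone_sensitive_blocks ::
  "'i set \<Rightarrow> (('i \<Rightarrow> bool) \<Rightarrow> bool) \<Rightarrow> ('i \<Rightarrow> bool) \<Rightarrow> 'i set set" where
  "monotone_sensitive_blocks I h x =
     {B. B \<subseteq> I \<and> B \<noteq> {} \<and> B \<inter> supp I x = {} \<and> h (flip x B) \<noteq> h x}"

definition mbs_at :: "'i set \<Rightarrow> (('i \<Rightarrow> bool) \<Rightarrow> bool) \<Rightarrow> ('i \<Rightarrow> bool) \<Rightarrow> nat" where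
  "mbs_at I h x = Max {card P | P. P \<subseteq> monotone_sensitive_blocks I h x \<and> disjoint P}"

definition mbs :: "'i set \<Rightarrow> (('i \<Rightarrow> bool) \<Rightarrow> bool) \<Rightarrow> nat" where
  "mbs I h = Max (mbs_at I h ` cube I)"

end

theory Submission
  imports Defs
begin

text \<open>
  Let \<open>P\<close> be a disjoint family of monotone sensitive blocks of \<open>f \<circ> g\<close> at \<open>x\<close> and \<open>y\<^sub>i = g(x\<^sup>i)\<close>.
  Flipping \<open>B \<in> P\<close> changes \<open>y\<close> exactly on some set \<open>S(B)\<close>, which is therefore a sensitive block of
  \<open>f\<close> at \<open>y\<close>. If \<open>i \<in> S(B)\<close>, then the \<open>i\<close>-th row of \<open>B\<close> is a monotone sensitive block of \<open>g\<close> at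
  \<open>x\<^sup>i\<close>, and these rows are disjoint for different \<open>B\<close>, so each \<open>i\<close> lies in at most \<open>mbs(g)\<close> of the
  sets \<open>S(B)\<close>. Hence giving weight \<open>1 / mbs(g)\<close> to each \<open>S(B)\<close>, counted with multiplicity, is
  feasible for \<open>fbs(f, y)\<close>, and its total weight is \<open>|P| / mbs(g)\<close>.
\<close>

lemma finite_cube: "finite I \<Longrightarrow> finite (cube I)"
  unfolding cube_def by (simp add: finite_PiE)

lemma cube_nonempty: "cube I \<noteq> {}"
  unfolding cube_def by (simp add: PiE_eq_empty_iff)

lemma finite_monotone_sensitive_blocks:
  "finite I \<Longrightarrow> finite (monotone_sensitive_blocks I h x)"
  by (rule finite_subset[of _ "Pow I"]) (auto simp: monotone_sensitive_blocks_def)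

lemma finite_sensitive_blocks: "finite I \<Longrightarrow> finite (sensitive_blocks I f y)"
  by (rule finite_subset[of _ "Pow I"]) (auto simp: sensitive_blocks_def)

lemma finite_disjoint_family_cards:
  assumes "finite I"
  shows "finite {card P | P. P \<subseteq> monotone_sensitive_blocks I h x \<and> disjoint P}"
proof (rule finite_subset)
  show "{card P | P. P \<subseteq> monotone_sensitive_blocks I h x \<and> disjoint P}
      \<subseteq> card ` Pow (monotone_sensitive_blocks I h x)" by auto
qed (simp add: finite_monotone_sensitive_blocks assms)

lemma card_le_mbs:
  assumes "finite I" "x \<in> cube I" "P \<subseteq> monotone_sensitive_blocks I h x" "disjoint P"
  shows "card P \<le> mbs I h"
proof -
  have "card P \<le> mbs_at I h x"
    unfolding mbs_at_def
    using assms by (intro Max_ge finite_disjoint_family_cards) auto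
  also have "\<dots> \<le> mbs I h"
    unfolding mbs_def using assms by (intro Max_ge) (auto simp: finite_cube)
  finally show ?thesis .
qed

lemma mbs_attained:
  assumes "finite I"
  obtains x P where "x \<in> cube I" "P \<subseteq> monotone_sensitive_blocks I h x" "disjoint P"
    "card P = mbs I h"
proof -
  have "mbs I h \<in> mbs_at I h ` cube I"
    unfolding mbs_def using assms by (intro Max_in) (auto simp: finite_cube cube_nonempty)
  then obtain x where x: "x \<in> cube I" "mbs I h = mbs_at I h x" by auto
  have "mbs_at I h x \<in> {card P | P. P \<subseteq> monotone_sensitive_blocks I h x \<and> disjoint P}"
    unfolding mbs_at_def
  proof (rule Max_in)
    \<comment> \<open>The empty family makes the maximum meaningful even where no block is
      sensitive.\<close>
    have "{} \<subseteq> monotone_sensitive_blocks I h x \<and> disjoint {}"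
      by simp
    then show "{card P | P. P \<subseteq> monotone_sensitive_blocks I h x \<and> disjoint P} \<noteq> {}"
      by blast
  qed (rule finite_disjoint_family_cards[OF assms])
  with x that show ?thesis by auto
qed

text \<open>A real \<open>Sup\<close> is sure to dominate its members only if they are bounded
  above. Every weight is at most 1, so the number of sensitive blocks is such a bound.\<close>

lemma fbs_feasible_le_fbs:
  assumes "finite I" "y \<in> cube I" "fbs_feasible I f y b"
  shows "(\<Sum>B\<in>sensitive_blocks I f y. b B) \<le> fbs I f"
proof -
  have "bdd_above {(\<Sum>B\<in>sensitive_blocks I f y. b B) | b. fbs_feasible I f y b}"
  proof (rule bdd_aboveI)
    fix s assume "s \<in> {(\<Sum>B\<in>sensitive_blocks I f y. b B) | b. fbs_feasible I f y b}"
    then obtain b where b: "s = (\<Sum>B\<in>sensitive_blocks I f y. b B)" "fbs_feasible I f y b"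
      by auto
    then show "s \<le> real (card (sensitive_blocks I f y)) * 1"
      unfolding b(1) by (intro sum_bounded_above) (auto simp: fbs_feasible_def)
  qed
  then have "(\<Sum>B\<in>sensitive_blocks I f y. b B) \<le> fbs_at I f y"
    unfolding fbs_at_def using assms by (intro cSup_upper) auto
  also have "\<dots> \<le> fbs I f"
    unfolding fbs_def using assms by (intro Max_ge) (auto simp: finite_cube)
  finally show ?thesis .
qed

lemma empty_not_sensitive: "{} \<notin> sensitive_blocks I f y"
  by (simp add: sensitive_blocks_def flip_def)

text \<open>The linear programming half of the argument. The blocks are indexed by \<open>P\<close>
  because distinct indices may yield the same sensitive block.\<close>

lemma card_le_fbs_mult:
  fixes S :: "'b \<Rightarrow> 'i set" and M :: nat
  assumes I: "finite I" and y: "y \<in> cube I" and P: "finite P"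
    and S: "\<And>B. B \<in> P \<Longrightarrow> S B \<in> sensitive_blocks I f y"
    and M: "\<And>i. i \<in> I \<Longrightarrow> card {B \<in> P. i \<in> S B} \<le> M"
  shows "real (card P) \<le> fbs I f * real M"
proof (cases "M = 0")
  \<comment> \<open>The weights used below divide by \<open>M\<close>. If \<open>M = 0\<close>, no
    coordinate lies in any \<open>S B\<close>, yet each \<open>S B\<close> is nonempty, so
    \<open>P\<close> is empty.\<close>
  case True
  have False if "B \<in> P" for B
  proof -
    from S[OF that] obtain i where "i \<in> I" "i \<in> S B"
      using empty_not_sensitive[of I f y] by (cases "S B = {}") (auto simp: sensitive_blocks_def)
    then show False using M[of i] True P that by auto
  qed
  then have "P = {}" by blast
  with True show ?thesis by simp
next
  case False
  let ?W = "sensitive_blocks I f y"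
  define b where "b C = real (card {B \<in> P. S B = C}) / real M" for C
  have W: "finite ?W" by (rule finite_sensitive_blocks[OF I])
  \<comment> \<open>Group \<open>P\<close> by the value of \<open>S\<close>. Taking for
    \<open>V\<close> the blocks through one coordinate gives the constraint; \<open>V = ?W\<close>
    gives the objective.\<close>
  have sum_b: "(\<Sum>C\<in>V. b C) = real (card {B \<in> P. S B \<in> V}) / real M" if "V \<subseteq> ?W" for V
  proof -
    have "finite V" using that W by (rule finite_subset)
    then have "(\<Sum>C\<in>V. card {B \<in> {B \<in> P. S B \<in> V}. S B = C}) = card {B \<in> P. S B \<in> V}"
      using P sum.group[of "{B \<in> P. S B \<in> V}" V S "\<lambda>_. 1::nat"] by auto
    moreover have "{B \<in> {B \<in> P. S B \<in> V}. S B = C} = {B \<in> P. S B = C}" if "C \<in> V" for C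
      using that by auto
    ultimately have "(\<Sum>C\<in>V. card {B \<in> P. S B = C}) = card {B \<in> P. S B \<in> V}" by simp
    then show ?thesis
      unfolding b_def by (simp flip: sum_divide_distrib of_nat_sum)
  qed
  have nonneg: "0 \<le> b C" for C by (simp add: b_def)
  have load: "(\<Sum>C\<in>{C \<in> ?W. i \<in> C}. b C) \<le> 1" if "i \<in> I" for i
  proof -
    have "{B \<in> P. S B \<in> {C \<in> ?W. i \<in> C}} = {B \<in> P. i \<in> S B}" using S by auto
    then show ?thesis using M[OF that] False by (simp add: sum_b)
  qed
  \<comment> \<open>A sensitive block is nonempty, so \<open>b C\<close> is one term in the load of
    some coordinate.\<close>
  have "b C \<le> 1" if C: "C \<in> ?W" for C
  proof -
    obtain i where i: "i \<in> I" "i \<in> C"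
      using C empty_not_sensitive[of I f y] by (cases "C = {}") (auto simp: sensitive_blocks_def)
    have "b C \<le> (\<Sum>C\<in>{C \<in> ?W. i \<in> C}. b C)"
      using C i W nonneg by (intro member_le_sum) auto
    with load[OF i(1)] show ?thesis by simp
  qed
  then have "fbs_feasible I f y b" using nonneg load by (simp add: fbs_feasible_def)
  from fbs_feasible_le_fbs[OF I y this] have "real (card {B \<in> P. S B \<in> ?W}) / real M \<le> fbs I f"
    by (simp add: sum_b)
  moreover have "{B \<in> P. S B \<in> ?W} = P" using S by auto
  ultimately show ?thesis using False by (simp add: field_simps)
qed

text \<open>The row of \<open>B\<close> stays inside \<open>J\<close>, so the flip on the right
  leaves the \<open>undefined\<close> values off \<open>J\<close> alone.\<close>

lemma row_flip:
  assumes "B \<subseteq> I \<times> J"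
  shows "(\<lambda>j\<in>J. flip x B (i, j)) = flip (\<lambda>j\<in>J. x (i, j)) (B `` {i})"
  using assms by (auto simp: flip_def fun_eq_iff)

text \<open>The row avoids the support because \<open>B\<close> does, and it is nonempty because
  flipping nothing cannot change the value of \<open>g\<close>.\<close>

lemma row_monotone_sensitive:
  assumes "B \<in> monotone_sensitive_blocks (I \<times> J) h x"
    and "g (\<lambda>j\<in>J. flip x B (i, j)) \<noteq> g (\<lambda>j\<in>J. x (i, j))"
  shows "B `` {i} \<in> monotone_sensitive_blocks J g (\<lambda>j\<in>J. x (i, j))"
proof -
  have B: "B \<subseteq> I \<times> J" "B \<inter> supp (I \<times> J) x = {}"
    using assms(1) by (auto simp: monotone_sensitive_blocks_def)
  have sens: "g (flip (\<lambda>j\<in>J. x (i, j)) (B `` {i})) \<noteq> g (\<lambda>j\<in>J. x (i, j))"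
    using assms(2) row_flip[OF B(1)] by simp
  moreover have "flip z {} = z" for z :: "'b \<Rightarrow> bool" by (simp add: flip_def)
  ultimately have "B `` {i} \<noteq> {}" by metis
  with sens B show ?thesis by (auto simp: monotone_sensitive_blocks_def supp_def)
qed

theorem theorem5:
  fixes n m :: nat
    and f g :: "(nat \<Rightarrow> bool) \<Rightarrow> bool"
  shows "real (mbs ({1..n} \<times> {1..m}) (block_comp n m f g)) \<le> fbs {1..n} f * real (mbs {1..m} g)"
proof -
  let ?I = "{1..n}" and ?J = "{1..m}" and ?h = "block_comp n m f g"
  obtain x P where P: "P \<subseteq> monotone_sensitive_blocks (?I \<times> ?J) ?h x" "disjoint P"
      "card P = mbs (?I \<times> ?J) ?h"
    by (rule mbs_attained[of "?I \<times> ?J" ?h]) auto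
  have fin: "finite P"
    by (rule finite_subset[OF P(1)]) (simp add: finite_monotone_sensitive_blocks)
  define row where "row x i = (\<lambda>j\<in>?J. x (i, j))" for x :: "nat \<times> nat \<Rightarrow> bool" and i
  define y where "y = (\<lambda>i\<in>?I. g (row x i))"
  define S where "S B = {i \<in> ?I. g (row (flip x B) i) \<noteq> g (row x i)}" for B
  have "real (card P) \<le> fbs ?I f * real (mbs ?J g)"
  proof (rule card_le_fbs_mult[where y = y and S = S])
    show "y \<in> cube ?I" by (simp add: y_def cube_def)
    fix B assume "B \<in> P"
    then have "?h (flip x B) \<noteq> ?h x" using P(1) by (auto simp: monotone_sensitive_blocks_def)
    moreover have "?h x = f y" by (simp add: block_comp_def y_def row_def)
    \<comment> \<open>For Boolean values, to change is to be negated, so the new outer input is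
      \<open>y\<close> flipped on \<open>S B\<close>.\<close>
    moreover have "(\<lambda>i\<in>?I. g (row (flip x B) i)) = flip y (S B)"
      by (auto simp: flip_def y_def S_def fun_eq_iff)
    then have "?h (flip x B) = f (flip y (S B))" by (simp add: block_comp_def row_def)
    ultimately show "S B \<in> sensitive_blocks ?I f y"
      by (auto simp: sensitive_blocks_def S_def)
  next
    fix i
    let ?Q = "{B \<in> P. i \<in> S B}"
    let ?slice = "\<lambda>B::(nat \<times> nat) set. B `` {i}"
    have mono: "?slice B \<in> monotone_sensitive_blocks ?J g (row x i)" if "B \<in> ?Q" for B
      unfolding row_def
      by (rule row_monotone_sensitive[of B ?I ?J ?h]) (use that P(1) in \<open>auto simp: S_def row_def\<close>)
    have disj: "?slice B \<inter> ?slice C = {}" if "B \<in> ?Q" "C \<in> ?Q" "B \<noteq> C" for B C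
      using that P(2) by (auto dest: disjointD)
    \<comment> \<open>Two equal disjoint slices would be empty, which sensitive slices are not;
      hence no member of \<open>?Q\<close> is lost by passing to slices.\<close>
    have "inj_on ?slice ?Q"
    proof (rule inj_onI, rule ccontr)
      fix B C assume BC: "B \<in> ?Q" "C \<in> ?Q" "?slice B = ?slice C" "B \<noteq> C"
      then have "?slice B = {}" using disj[of B C] by simp
      then show False using mono[OF BC(1)] by (simp add: monotone_sensitive_blocks_def)
    qed
    then have "card ?Q = card (?slice ` ?Q)" by (rule card_image[symmetric])
    also have "\<dots> \<le> mbs ?J g"
    proof (rule card_le_mbs)
      show "row x i \<in> cube ?J" by (simp add: row_def cube_def)
      show "?slice ` ?Q \<subseteq> monotone_sensitive_blocks ?J g (row x i)" using mono by blast
      show "disjoint (?slice ` ?Q)"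
      proof (rule disjointI)
        fix X Y assume "X \<in> ?slice ` ?Q" "Y \<in> ?slice ` ?Q" "X \<noteq> Y"
        then obtain B C where "B \<in> ?Q" "C \<in> ?Q" "X = ?slice B" "Y = ?slice C" "B \<noteq> C" by blast
        then show "X \<inter> Y = {}" using disj by blast
      qed
    qed simp
    finally show "card ?Q \<le> mbs ?J g" .
  qed (use fin in auto)
  then show ?thesis by (simp only: P(3))
qed

end
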